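(* (1) A sample space $(X,R)$ in $\mathbf{SetMulti}$, with $\emptyset\neq R\subseteq X$, is faithful if and only if $R=X$. (2) The category $\mathcal P(\mathbf{SetMulti})$ is dagger equivalent to the category $\mathbf{TotRel}$ whose objects are nonempty sets and whose morphisms $X\to Y$ are total relations $R\subseteq X\times Y$ (that is, $\forall x\,\exists y\,(x,y)\in R$ and $\forall y\,\exists x\,(x,y)\in R$), with dagger given by the relational converse. (3) The category $\mathcal S(\mathbf{SetMulti})$ is equivalent to the category $\mathbf{Surj}$ of nonempty sets and surjections.
   Context: $\mathbf{SetMulti}$ is the category whose objects are sets and whose morphisms $X\to Y$ are left-total relations $R\subseteq X\times Y$ (for all $x$ there is $y$ with $(x,y)\in R$), with relational composition. It is a Markov category with tensor the cartesian product of sets and relations, unit $I$ a one-point set, and $\mathrm{copy}_X:X\to X\otimes X$ the graph of $x\mapsto(x,x)$. A state $I\to X$ is the same as a nonempty subset $R\subseteq X$. For a Markov category $\mathsf C$ (with conditionals, as holds here): for a state $p:I\to X$ and $f,g:X\to Y$, $f=_pg$ ($p$-almost sure equality) means $(\mathrm{id}_X\otimes f)\circ\mathrm{copy}_X\circ p=(\mathrm{id}_X\otimes g)\circ\mathrm{copy}_X\circ p$; $f$ is $p$-almost surely deterministic if $\mathrm{copy}_Y\circ f=_p(f\otimes f)\circ\mathrm{copy}_X$. $\mathcal P(\mathsf C)$ has as objects probability spaces (also called sample spaces) $(\Omega,p)$ with $p:I\to\Omega$ a state, and as morphisms $(\Omega,p)\to(\Omega',q)$ the $p$-almost sure equality classes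 of $f:\Omega\to\Omega'$ with $f\circ p=q$. $\mathcal S(\mathsf C)$ is its wide subcategory of classes of $p$-almost surely deterministic morphisms. An object $(\Omega,p)$ is faithful if for all objects $X$ and $f,g:\Omega\to X$ in $\mathsf C$, $f=_pg$ implies $f=g$. $\mathcal P(\mathsf C)$ is a dagger category under Bayesian inversion: for $f:(X,p)\to(Y,q)$, $f^\dagger:(Y,q)\to(X,p)$ is the class of any $f^\dagger_p:Y\to X$ with $(\mathrm{id}_X\otimes f)\circ\mathrm{copy}_X\circ p=(f_p^\dagger\otimes\mathrm{id}_Y)\circ\mathrm{copy}_Y\circ f\circ p$. A dagger equivalence consists of dagger-preserving functors $F,G$ and natural isomorphisms $FG\cong 1$, $GF\cong 1$ whose components are unitary ($f^{-1}=f^\dagger$). *)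

theory Defs
  imports Main "HOL-Library.FuncSet" "HOL-Library.Nat_Bijection"
begin

section \<open>Categories, functors, equivalences\<close>

record ('o, 'm) category =
  Obj :: "'o set"
  Arr :: "'m set"
  Dom :: "'m \<Rightarrow> 'o"
  Cod :: "'m \<Rightarrow> 'o"
  Ident :: "'o \<Rightarrow> 'm"
  Comp :: "'m \<Rightarrow> 'm \<Rightarrow> 'm" (infixr "\<cdot>\<index>" 70)

definition hom :: "('o, 'm, 'z) category_scheme \<Rightarrow> 'o \<Rightarrow> 'o \<Rightarrow> 'm set" where
  "hom C A B = {f \<in> Arr C. Dom C f = A \<and> Cod C f = B}"

locale category =
  fixes C :: "('o, 'm, 'z) category_scheme" (structure)
  assumes dom_in_Obj: "f \<in> Arr C \<Longrightarrow> Dom C f \<in> Obj C"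
    and cod_in_Obj: "f \<in> Arr C \<Longrightarrow> Cod C f \<in> Obj C"
    and Ident_in_hom: "A \<in> Obj C \<Longrightarrow> Ident C A \<in> hom C A A"
    and Comp_in_hom: "f \<in> hom C A B \<Longrightarrow> g \<in> hom C B D \<Longrightarrow> g \<cdot> f \<in> hom C A D"
    and Comp_Ident: "f \<in> hom C A B \<Longrightarrow> f \<cdot> Ident C A = f"
    and Ident_Comp: "f \<in> hom C A B \<Longrightarrow> Ident C B \<cdot> f = f"
    and Comp_assoc: "f \<in> hom C A B \<Longrightarrow> g \<in> hom C B D \<Longrightarrow> h \<in> hom C D E
          \<Longrightarrow> (h \<cdot> g) \<cdot> f = h \<cdot> (g \<cdot> f)"

definition iso :: "('o, 'm, 'z) category_scheme \<Rightarrow> 'm \<Rightarrow> bool" where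
  "iso C f \<longleftrightarrow> f \<in> Arr C \<and> (\<exists>g \<in> hom C (Cod C f) (Dom C f).
     g \<cdot>\<^bsub>C\<^esub> f = Ident C (Dom C f) \<and> f \<cdot>\<^bsub>C\<^esub> g = Ident C (Cod C f))"

record ('o, 'm) dagger_category = "('o, 'm) category" +
  Dag :: "'m \<Rightarrow> 'm"

locale dagger_category = category C
  for C :: "('o, 'm, 'z) dagger_category_scheme" (structure) +
  assumes Dag_in_hom: "f \<in> hom C A B \<Longrightarrow> Dag C f \<in> hom C B A"
    and Dag_Dag: "f \<in> Arr C \<Longrightarrow> Dag C (Dag C f) = f"
    and Dag_Ident: "A \<in> Obj C \<Longrightarrow> Dag C (Ident C A) = Ident C A"
    and Dag_Comp: "f \<in> hom C A B \<Longrightarrow> g \<in> hom C B D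
          \<Longrightarrow> Dag C (g \<cdot> f) = Dag C f \<cdot> Dag C g"

definition unitary :: "('o, 'm, 'z) dagger_category_scheme \<Rightarrow> 'm \<Rightarrow> bool" where
  "unitary C f \<longleftrightarrow> f \<in> Arr C \<and> Dag C f \<cdot>\<^bsub>C\<^esub> f = Ident C (Dom C f)
     \<and> f \<cdot>\<^bsub>C\<^esub> Dag C f = Ident C (Cod C f)"

record ('o1, 'm1, 'o2, 'm2) functor_data =
  on_Obj :: "'o1 \<Rightarrow> 'o2"
  on_Arr :: "'m1 \<Rightarrow> 'm2"

definition id_functor :: "('o, 'm, 'o, 'm) functor_data" where
  "id_functor = \<lparr>on_Obj = (\<lambda>A. A), on_Arr = (\<lambda>f. f)\<rparr>"

definition comp_functor ::
  "('o2, 'm2, 'o3, 'm3) functor_data \<Rightarrow> ('o1, 'm1, 'o2, 'm2) functor_data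
     \<Rightarrow> ('o1, 'm1, 'o3, 'm3) functor_data" where
  "comp_functor G F =
     \<lparr>on_Obj = on_Obj G \<circ> on_Obj F, on_Arr = on_Arr G \<circ> on_Arr F\<rparr>"

definition is_functor :: "('o1, 'm1, 'y) category_scheme \<Rightarrow> ('o2, 'm2, 'z) category_scheme
     \<Rightarrow> ('o1, 'm1, 'o2, 'm2) functor_data \<Rightarrow> bool" where
  "is_functor C D F \<longleftrightarrow> category C \<and> category D
     \<and> (\<forall>A \<in> Obj C. on_Obj F A \<in> Obj D)
     \<and> (\<forall>f \<in> Arr C. on_Arr F f \<in> hom D (on_Obj F (Dom C f)) (on_Obj F (Cod C f)))
     \<and> (\<forall>A \<in> Obj C. on_Arr F (Ident C A) = Ident D (on_Obj F A))
     \<and> (\<forall>f \<in> Arr C. \<forall>g \<in> Arr C. Cod C f = Dom C g \<longrightarrow>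
          on_Arr F (g \<cdot>\<^bsub>C\<^esub> f) = on_Arr F g \<cdot>\<^bsub>D\<^esub> on_Arr F f)"

definition is_dagger_functor ::
  "('o1, 'm1, 'y) dagger_category_scheme \<Rightarrow> ('o2, 'm2, 'z) dagger_category_scheme
     \<Rightarrow> ('o1, 'm1, 'o2, 'm2) functor_data \<Rightarrow> bool" where
  "is_dagger_functor C D F \<longleftrightarrow> dagger_category C \<and> dagger_category D \<and> is_functor C D F
     \<and> (\<forall>f \<in> Arr C. on_Arr F (Dag C f) = Dag D (on_Arr F f))"

definition nat_trans :: "('o1, 'm1, 'y) category_scheme \<Rightarrow> ('o2, 'm2, 'z) category_scheme
     \<Rightarrow> ('o1, 'm1, 'o2, 'm2) functor_data \<Rightarrow> ('o1, 'm1, 'o2, 'm2) functor_data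
     \<Rightarrow> ('o1 \<Rightarrow> 'm2) \<Rightarrow> bool" where
  "nat_trans C D F G \<tau> \<longleftrightarrow>
     (\<forall>A \<in> Obj C. \<tau> A \<in> hom D (on_Obj F A) (on_Obj G A))
     \<and> (\<forall>f \<in> Arr C. \<tau> (Cod C f) \<cdot>\<^bsub>D\<^esub> on_Arr F f = on_Arr G f \<cdot>\<^bsub>D\<^esub> \<tau> (Dom C f))"

definition nat_iso :: "('o1, 'm1, 'y) category_scheme \<Rightarrow> ('o2, 'm2, 'z) category_scheme
     \<Rightarrow> ('o1, 'm1, 'o2, 'm2) functor_data \<Rightarrow> ('o1, 'm1, 'o2, 'm2) functor_data
     \<Rightarrow> ('o1 \<Rightarrow> 'm2) \<Rightarrow> bool" where
  "nat_iso C D F G \<tau> \<longleftrightarrow> nat_trans C D F G \<tau> \<and> (\<forall>A \<in> Obj C. iso D (\<tau> A))"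

definition equivalent ::
  "('o1, 'm1, 'y) category_scheme \<Rightarrow> ('o2, 'm2, 'z) category_scheme \<Rightarrow> bool" where
  "equivalent C D \<longleftrightarrow> (\<exists>F G \<eta> \<epsilon>. is_functor C D F \<and> is_functor D C G
     \<and> nat_iso C C (comp_functor G F) id_functor \<eta>
     \<and> nat_iso D D (comp_functor F G) id_functor \<epsilon>)"

definition dagger_equivalent ::
  "('o1, 'm1, 'y) dagger_category_scheme \<Rightarrow> ('o2, 'm2, 'z) dagger_category_scheme \<Rightarrow> bool"
  where
  "dagger_equivalent C D \<longleftrightarrow>
     (\<exists>F G \<eta> \<epsilon>. is_dagger_functor C D F \<and> is_dagger_functor D C G
     \<and> nat_iso C C (comp_functor G F) id_functor \<eta> \<and> (\<forall>A \<in> Obj C. unitary C (\<eta> A))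
     \<and> nat_iso D D (comp_functor F G) id_functor \<epsilon> \<and> (\<forall>B \<in> Obj D. unitary D (\<epsilon> B)))"

section \<open>Sample spaces in a Markov category\<close>

text \<open>Only the part of the Markov category structure that enters the definitions below is
  recorded; associators, unitors, symmetry and discarding maps play no role in them.\<close>

record ('o, 'm) markov = "('o, 'm) category" +
  UnitObj :: "'o"
  TensorObj :: "'o \<Rightarrow> 'o \<Rightarrow> 'o"
  Tensor :: "'m \<Rightarrow> 'm \<Rightarrow> 'm" (infixr "\<otimes>\<index>" 75)
  Copy :: "'o \<Rightarrow> 'm"

definition as_eq :: "('o, 'm, 'z) markov_scheme \<Rightarrow> 'm \<Rightarrow> 'm \<Rightarrow> 'm \<Rightarrow> bool" where
  "as_eq C p f g \<longleftrightarrow>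
     (Ident C (Cod C p) \<otimes>\<^bsub>C\<^esub> f) \<cdot>\<^bsub>C\<^esub> Copy C (Cod C p) \<cdot>\<^bsub>C\<^esub> p
     = (Ident C (Cod C p) \<otimes>\<^bsub>C\<^esub> g) \<cdot>\<^bsub>C\<^esub> Copy C (Cod C p) \<cdot>\<^bsub>C\<^esub> p"

definition as_deterministic :: "('o, 'm, 'z) markov_scheme \<Rightarrow> 'm \<Rightarrow> 'm \<Rightarrow> bool" where
  "as_deterministic C p f \<longleftrightarrow>
     as_eq C p (Copy C (Cod C f) \<cdot>\<^bsub>C\<^esub> f) ((f \<otimes>\<^bsub>C\<^esub> f) \<cdot>\<^bsub>C\<^esub> Copy C (Dom C f))"

definition as_class :: "('o, 'm, 'z) markov_scheme \<Rightarrow> 'm \<Rightarrow> 'm \<Rightarrow> 'm set" where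
  "as_class C p f = {g \<in> hom C (Dom C f) (Cod C f). as_eq C p f g}"

definition bayesian_inverse ::
  "('o, 'm, 'z) markov_scheme \<Rightarrow> 'm \<Rightarrow> 'm \<Rightarrow> 'm \<Rightarrow> bool" where
  "bayesian_inverse C p f g \<longleftrightarrow> g \<in> hom C (Cod C f) (Dom C f) \<and>
     (Ident C (Dom C f) \<otimes>\<^bsub>C\<^esub> f) \<cdot>\<^bsub>C\<^esub> Copy C (Dom C f) \<cdot>\<^bsub>C\<^esub> p
     = (g \<otimes>\<^bsub>C\<^esub> Ident C (Cod C f)) \<cdot>\<^bsub>C\<^esub> Copy C (Cod C f) \<cdot>\<^bsub>C\<^esub> f \<cdot>\<^bsub>C\<^esub> p"

definition sample_spaces :: "('o, 'm, 'z) markov_scheme \<Rightarrow> ('o \<times> 'm) set" where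
  "sample_spaces C = {(\<Omega>, p). \<Omega> \<in> Obj C \<and> p \<in> hom C (UnitObj C) \<Omega>}"

definition faithful :: "('o, 'm, 'z) markov_scheme \<Rightarrow> 'o \<times> 'm \<Rightarrow> bool" where
  "faithful C = (\<lambda>(\<Omega>, p). \<forall>X \<in> Obj C. \<forall>f \<in> hom C \<Omega> X. \<forall>g \<in> hom C \<Omega> X.
     as_eq C p f g \<longrightarrow> f = g)"

type_synonym ('o, 'm) prob_arr = "('o \<times> 'm) \<times> 'm set \<times> ('o \<times> 'm)"

text \<open>A morphism is a triple of source, almost sure equality class and target. Composition and
  dagger collect the results for all choices of representatives (and of Bayesian inverses); that
  these sets are again single almost sure equality classes is the closure of the arrows under
  composition and dagger, demanded by the locales \<^locale>\<open>category\<close> and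
  \<^locale>\<open>dagger_category\<close>.\<close>

definition Prob ::
  "('o, 'm, 'z) markov_scheme \<Rightarrow> ('o \<times> 'm, ('o, 'm) prob_arr) dagger_category" where
  "Prob C = \<lparr>
     Obj = sample_spaces C,
     Arr = {((X, p), as_class C p f, (Y, q)) | X p f Y q.
              (X, p) \<in> sample_spaces C \<and> (Y, q) \<in> sample_spaces C
              \<and> f \<in> hom C X Y \<and> f \<cdot>\<^bsub>C\<^esub> p = q},
     Dom = (\<lambda>(A, F, B). A),
     Cod = (\<lambda>(A, F, B). B),
     Ident = (\<lambda>(X, p). ((X, p), as_class C p (Ident C X), (X, p))),
     Comp = (\<lambda>(B', G, D) ((X, p), F, B).
              ((X, p), \<Union>{as_class C p (g \<cdot>\<^bsub>C\<^esub> f) | g f. g \<in> G \<and> f \<in> F}, D)),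
     Dag = (\<lambda>((X, p), F, B). (B, {g. \<exists>f \<in> F. bayesian_inverse C p f g}, (X, p)))\<rparr>"

definition DetProb ::
  "('o, 'm, 'z) markov_scheme \<Rightarrow> ('o \<times> 'm, ('o, 'm) prob_arr) category" where
  "DetProb C = \<lparr>
     Obj = Obj (Prob C),
     Arr = {((X, p), F, B) | X p F B.
              ((X, p), F, B) \<in> Arr (Prob C) \<and> (\<exists>f \<in> F. as_deterministic C p f)},
     Dom = Dom (Prob C),
     Cod = Cod (Prob C),
     Ident = Ident (Prob C),
     Comp = Comp (Prob C)\<rparr>"

section \<open>Set-based categories\<close>

text \<open>The collection of all sets is modelled by a family \<open>U\<close> of sets over a type \<open>'u\<close>, with an
  encoding \<open>pr\<close> of ordered pairs and a chosen point \<open>pt\<close>. Both the family of all sets over an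
  infinite type and the family of small sets over a type of ZF sets are instances.\<close>

locale set_universe =
  fixes U :: "'u set set" and pr :: "'u \<Rightarrow> 'u \<Rightarrow> 'u" and pt :: 'u
  assumes pr_eq_iff: "pr x y = pr x' y' \<longleftrightarrow> x = x' \<and> y = y'"
    and subset_closed: "X \<in> U \<Longrightarrow> Y \<subseteq> X \<Longrightarrow> Y \<in> U"
    and product_closed: "X \<in> U \<Longrightarrow> Y \<in> U \<Longrightarrow> {pr x y | x y. x \<in> X \<and> y \<in> Y} \<in> U"
    and point_in: "{pt} \<in> U"
    and two_points_in: "\<exists>a b. a \<noteq> b \<and> {a, b} \<in> U"

lemma set_universe_nat: "set_universe UNIV (\<lambda>x y. prod_encode (x, y)) 0"
  by unfold_locales (auto intro: exI[of _ 0] exI[of _ 1])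

type_synonym 'u rel_arr = "'u set \<times> ('u \<times> 'u) set \<times> 'u set"

definition left_total_rel :: "'u set \<Rightarrow> ('u \<times> 'u) set \<Rightarrow> 'u set \<Rightarrow> bool" where
  "left_total_rel X R Y \<longleftrightarrow> R \<subseteq> X \<times> Y \<and> (\<forall>x \<in> X. \<exists>y \<in> Y. (x, y) \<in> R)"

definition total_rel :: "'u set \<Rightarrow> ('u \<times> 'u) set \<Rightarrow> 'u set \<Rightarrow> bool" where
  "total_rel X R Y \<longleftrightarrow> R \<subseteq> X \<times> Y
     \<and> (\<forall>x \<in> X. \<exists>y \<in> Y. (x, y) \<in> R) \<and> (\<forall>y \<in> Y. \<exists>x \<in> X. (x, y) \<in> R)"

definition times_in :: "('u \<Rightarrow> 'u \<Rightarrow> 'u) \<Rightarrow> 'u set \<Rightarrow> 'u set \<Rightarrow> 'u set" where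
  "times_in pr X Y = {pr x y | x y. x \<in> X \<and> y \<in> Y}"

definition SetMulti ::
  "'u set set \<Rightarrow> ('u \<Rightarrow> 'u \<Rightarrow> 'u) \<Rightarrow> 'u \<Rightarrow> ('u set, 'u rel_arr) markov" where
  "SetMulti U pr pt = \<lparr>
     Obj = U,
     Arr = {(X, R, Y). X \<in> U \<and> Y \<in> U \<and> left_total_rel X R Y},
     Dom = (\<lambda>(X, R, Y). X),
     Cod = (\<lambda>(X, R, Y). Y),
     Ident = (\<lambda>X. (X, Id_on X, X)),
     Comp = (\<lambda>(Y', S, Z) (X, R, Y). (X, R O S, Z)),
     UnitObj = {pt},
     TensorObj = times_in pr,
     Tensor = (\<lambda>(X, R, Y) (X', R', Y').
       (times_in pr X X',
        {(pr x x', pr y y') | x x' y y'. (x, y) \<in> R \<and> (x', y') \<in> R'},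
        times_in pr Y Y')),
     Copy = (\<lambda>X. (X, {(x, pr x x) | x. x \<in> X}, times_in pr X X))\<rparr>"

definition subset_state :: "'u \<Rightarrow> 'u set \<Rightarrow> 'u set \<Rightarrow> 'u rel_arr" where
  "subset_state pt X R = ({pt}, {pt} \<times> R, X)"

definition TotRel :: "'u set set \<Rightarrow> ('u set, 'u rel_arr) dagger_category" where
  "TotRel U = \<lparr>
     Obj = {X \<in> U. X \<noteq> {}},
     Arr = {(X, R, Y). X \<in> U \<and> X \<noteq> {} \<and> Y \<in> U \<and> Y \<noteq> {} \<and> total_rel X R Y},
     Dom = (\<lambda>(X, R, Y). X),
     Cod = (\<lambda>(X, R, Y). Y),
     Ident = (\<lambda>X. (X, Id_on X, X)),
     Comp = (\<lambda>(Y', S, Z) (X, R, Y). (X, R O S, Z)),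
     Dag = (\<lambda>(X, R, Y). (Y, R\<inverse>, X))\<rparr>"

definition Surj :: "'u set set \<Rightarrow> ('u set, 'u set \<times> ('u \<Rightarrow> 'u) \<times> 'u set) category" where
  "Surj U = \<lparr>
     Obj = {X \<in> U. X \<noteq> {}},
     Arr = {(X, f, Y). X \<in> U \<and> X \<noteq> {} \<and> Y \<in> U \<and> Y \<noteq> {} \<and> f \<in> X \<rightarrow>\<^sub>E Y \<and> f ` X = Y},
     Dom = (\<lambda>(X, f, Y). X),
     Cod = (\<lambda>(X, f, Y). Y),
     Ident = (\<lambda>X. (X, \<lambda>x\<in>X. x, X)),
     Comp = (\<lambda>(Y', g, Z) (X, f, Y). (X, compose X g f, Z))\<rparr>"

end

theory Submission imports Defs begin

text \<open>A state of \<open>X\<close> is a nonempty subset \<open>R\<close>, and almost sure equality of relations on \<open>X\<close> is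
  equality of their restrictions to \<open>R\<close> (lemma \<open>as_eq_SM\<close>). So almost sure equality is equality
  when \<open>R = X\<close>; otherwise two relations into a two-element set that differ only on \<open>X - R\<close> are
  almost surely equal, which gives the statement on faithfulness.

  Consequently a morphism \<open>(X, R) \<rightarrow> (Y, Q)\<close> of probability spaces is nothing but the restriction
  \<open>K\<close> of its representatives to \<open>R\<close>. Preservation of the states says that the image of \<open>R\<close> is
  \<open>Q\<close>, so \<open>K\<close> is a total relation from \<open>R\<close> to \<open>Q\<close>; conversely every total relation from \<open>R\<close> to
  \<open>Q\<close> extends to a left-total relation from \<open>X\<close> to \<open>Y\<close>, by relating the points outside \<open>R\<close> to
  all of the nonempty set \<open>Q\<close> (lemma \<open>hom_Prob\<close>). Under this bijection composition is relational
  composition, and Bayesian inversion is the converse, because the joint state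
  of \<open>R\<close> and a relation is the set of pairs in its restriction to \<open>R\<close>. A morphism is almost surely
  deterministic exactly if \<open>K\<close> is single-valued, that is, the graph of a surjection of \<open>R\<close> onto
  \<open>Q\<close> (lemma \<open>hom_DetProb\<close>).

  So passing to supports is fully faithful, and it has a strict section on objects that equips a
  set with itself as support. Both equivalences are instances of one abstract fact: bijections on
  hom-sets that preserve composition, identities and daggers pull the axioms of a (dagger) category
  back along the assignment, and a section on objects then yields a (dagger)
  equivalence (locales \<open>fully_faithful_retraction\<close>, \<open>dagger_fully_faithful_retraction\<close>).\<close>

section \<open>Equivalences from fully faithful assignments with a section on objects\<close>

lemma in_homD: "f \<in> hom C A B \<Longrightarrow> f \<in> Arr C \<and> Dom C f = A \<and> Cod C f = B"
  by (simp add: hom_def)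

lemma in_homI: "f \<in> Arr C \<Longrightarrow> f \<in> hom C (Dom C f) (Cod C f)"
  by (simp add: hom_def)

text \<open>The category laws of \<open>C\<close> are consequences: \<open>F\<close> is injective on hom-sets, so every equation between
  arrows of \<open>C\<close> may be checked in \<open>D\<close>.\<close>

locale fully_faithful_retraction = D: category D
  for D :: "('o2, 'm2, 'z) category_scheme" +
  fixes C :: "('o1, 'm1, 'y) category_scheme"
    and F :: "('o1, 'm1, 'o2, 'm2) functor_data"
    and S :: "'o2 \<Rightarrow> 'o1"
  assumes F_Obj: "A \<in> Obj C \<Longrightarrow> on_Obj F A \<in> Obj D"
    and S_Obj: "X \<in> Obj D \<Longrightarrow> S X \<in> Obj C"
    and F_S: "X \<in> Obj D \<Longrightarrow> on_Obj F (S X) = X"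
    and C_dom: "f \<in> Arr C \<Longrightarrow> Dom C f \<in> Obj C"
    and C_cod: "f \<in> Arr C \<Longrightarrow> Cod C f \<in> Obj C"
    and C_Ident: "A \<in> Obj C \<Longrightarrow> Ident C A \<in> hom C A A"
    and F_Ident: "A \<in> Obj C \<Longrightarrow> on_Arr F (Ident C A) = Ident D (on_Obj F A)"
    and C_Comp: "f \<in> hom C A B \<Longrightarrow> g \<in> hom C B E \<Longrightarrow> Comp C g f \<in> hom C A E"
    and F_Comp: "f \<in> hom C A B \<Longrightarrow> g \<in> hom C B E
          \<Longrightarrow> on_Arr F (Comp C g f) = Comp D (on_Arr F g) (on_Arr F f)"
    and F_bij: "A \<in> Obj C \<Longrightarrow> B \<in> Obj C
          \<Longrightarrow> bij_betw (on_Arr F) (hom C A B) (hom D (on_Obj F A) (on_Obj F B))"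
begin

lemma hom_Obj: "f \<in> hom C A B \<Longrightarrow> A \<in> Obj C \<and> B \<in> Obj C"
  using C_dom C_cod by (auto simp: hom_def)

lemma F_hom: "f \<in> hom C A B \<Longrightarrow> on_Arr F f \<in> hom D (on_Obj F A) (on_Obj F B)"
  using F_bij hom_Obj bij_betwE by blast

lemma F_eqI: "f \<in> hom C A B \<Longrightarrow> g \<in> hom C A B \<Longrightarrow> on_Arr F f = on_Arr F g \<Longrightarrow> f = g"
  using F_bij[of A B] hom_Obj[of f A B] by (auto simp: bij_betw_def dest: inj_onD)

lemma category_C: "category C"
proof
  show "Comp C f (Ident C A) = f" if f: "f \<in> hom C A B" for f A B
    using f hom_Obj[OF f] C_Comp[OF C_Ident f] F_Comp[OF C_Ident f] F_hom[OF f]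
    by (intro F_eqI[of _ A B]) (auto simp: F_Ident D.Comp_Ident)
  show "Comp C (Ident C B) f = f" if f: "f \<in> hom C A B" for f A B
    using f hom_Obj[OF f] C_Comp[OF f C_Ident] F_Comp[OF f C_Ident] F_hom[OF f]
    by (intro F_eqI[of _ A B]) (auto simp: F_Ident D.Ident_Comp)
  show "Comp C (Comp C h g) f = Comp C h (Comp C g f)"
    if f: "f \<in> hom C A B" and g: "g \<in> hom C B B'" and h: "h \<in> hom C B' E" for f g h A B B' E
  proof (rule F_eqI[of _ A E])
    show "Comp C (Comp C h g) f \<in> hom C A E" "Comp C h (Comp C g f) \<in> hom C A E"
      using f g h C_Comp by blast+
    show "on_Arr F (Comp C (Comp C h g) f) = on_Arr F (Comp C h (Comp C g f))"
      using F_Comp[OF f C_Comp[OF g h]] F_Comp[OF C_Comp[OF f g] h] F_Comp[OF f g] F_Comp[OF g h]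
        D.Comp_assoc[OF F_hom[OF f] F_hom[OF g] F_hom[OF h]] by simp
  qed
qed (use C_dom C_cod C_Ident C_Comp in auto)

sublocale C: category C
  by (rule category_C)

definition lift :: "'o1 \<Rightarrow> 'o1 \<Rightarrow> 'm2 \<Rightarrow> 'm1" where
  "lift A B h = inv_into (hom C A B) (on_Arr F) h"

lemma
  assumes "A \<in> Obj C" "B \<in> Obj C" "h \<in> hom D (on_Obj F A) (on_Obj F B)"
  shows lift_hom: "lift A B h \<in> hom C A B" and F_lift: "on_Arr F (lift A B h) = h"
proof -
  have "h \<in> on_Arr F ` hom C A B"
    using F_bij[OF assms(1,2)] assms(3) by (simp add: bij_betw_def)
  then show "lift A B h \<in> hom C A B" "on_Arr F (lift A B h) = h"
    by (auto simp: lift_def inv_into_into f_inv_into_f)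
qed

definition section_functor :: "('o2, 'm2, 'o1, 'm1) functor_data" where
  "section_functor = \<lparr>on_Obj = S, on_Arr = (\<lambda>h. lift (S (Dom D h)) (S (Cod D h)) h)\<rparr>"

text \<open>The component at \<open>A\<close> of the isomorphism from \<open>S (F A)\<close> to \<open>A\<close>: both objects have the image
  \<open>F A\<close>, so the identity of \<open>F A\<close> lifts in both directions.\<close>

definition counit :: "'o1 \<Rightarrow> 'm1" where
  "counit A = lift (S (on_Obj F A)) A (Ident D (on_Obj F A))"

lemma
  assumes "A \<in> Obj C"
  shows counit_hom: "counit A \<in> hom C (S (on_Obj F A)) A"
    and F_counit: "on_Arr F (counit A) = Ident D (on_Obj F A)"
  using assms D.Ident_in_hom[OF F_Obj[OF assms]]
  by (auto simp: counit_def F_Obj S_Obj F_S intro!: lift_hom F_lift)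

text \<open>Since \<open>F (S B) = B\<close> holds strictly, \<open>F\<close> undoes the section also on arrows, so the composite on
  \<open>D\<close> is the identity and the identities of \<open>D\<close> form its natural isomorphism.\<close>

lemma
  assumes "h \<in> hom D A B"
  shows section_hom: "on_Arr section_functor h \<in> hom C (S A) (S B)"
    and F_section: "on_Arr F (on_Arr section_functor h) = h"
proof -
  have "A \<in> Obj D" "B \<in> Obj D"
    using assms D.dom_in_Obj D.cod_in_Obj by (auto simp: hom_def)
  with assms show "on_Arr section_functor h \<in> hom C (S A) (S B)" "on_Arr F (on_Arr section_functor h) = h"
    by (auto simp: section_functor_def in_homD[OF assms] F_S S_Obj intro!: lift_hom F_lift)
qed

lemma functor_F: "is_functor C D F"
  unfolding is_functor_def
  using category_C D.category_axioms F_Obj F_Ident F_hom[OF in_homI] F_Comp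
  by (auto simp: hom_def)

lemma functor_section: "is_functor D C section_functor"
proof -
  have ident: "on_Arr section_functor (Ident D A) = Ident C (S A)" if A: "A \<in> Obj D" for A
    using section_hom[OF D.Ident_in_hom[OF A]] F_section[OF D.Ident_in_hom[OF A]]
      C_Ident[OF S_Obj[OF A]] F_Ident[OF S_Obj[OF A]] F_S[OF A]
    by (intro F_eqI) auto
  have comp: "on_Arr section_functor (Comp D g f) = Comp C (on_Arr section_functor g) (on_Arr section_functor f)"
    if f: "f \<in> hom D A B" and g: "g \<in> hom D B E" for f g A B E
    using section_hom[OF D.Comp_in_hom[OF f g]] F_section[OF D.Comp_in_hom[OF f g]]
      C_Comp[OF section_hom[OF f] section_hom[OF g]] F_section[OF f] F_section[OF g]
      F_Comp[OF section_hom[OF f] section_hom[OF g]]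
    by (intro F_eqI) auto
  show ?thesis
    unfolding is_functor_def
    using category_C D.category_axioms S_Obj ident section_hom[OF in_homI] comp
    by (auto simp: hom_def section_functor_def)
qed

text \<open>Naturality and invertibility hold after applying \<open>F\<close>, where the components are identities.\<close>

lemma counit_nat_iso: "nat_iso C C (comp_functor section_functor F) id_functor counit"
proof -
  have natural: "Comp C (counit B) (on_Arr section_functor (on_Arr F f)) = Comp C f (counit A)"
    if f: "f \<in> hom C A B" for f A B
  proof -
    have A: "A \<in> Obj C" and B: "B \<in> Obj C"
      using hom_Obj[OF f] by auto
    note r = section_hom[OF F_hom[OF f]]
    show ?thesis
      using C_Comp[OF r counit_hom[OF B]] F_Comp[OF r counit_hom[OF B]]
        C_Comp[OF counit_hom[OF A] f] F_Comp[OF counit_hom[OF A] f]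
        F_section[OF F_hom[OF f]] F_counit[OF A] F_counit[OF B]
        D.Comp_Ident[OF F_hom[OF f]] D.Ident_Comp[OF F_hom[OF f]]
      by (intro F_eqI) auto
  qed
  have iso: "iso C (counit A)" if A: "A \<in> Obj C" for A
  proof -
    note FA = F_Obj[OF A] and SFA = S_Obj[OF F_Obj[OF A]]
    define u where "u = lift A (S (on_Obj F A)) (Ident D (on_Obj F A))"
    have u: "u \<in> hom C A (S (on_Obj F A))" and Fu: "on_Arr F u = Ident D (on_Obj F A)"
      using lift_hom[OF A SFA] F_lift[OF A SFA] D.Ident_in_hom[OF FA] F_S[OF FA]
      by (auto simp: u_def)
    note c = counit_hom[OF A] and Fc = F_counit[OF A]
    have "Comp C u (counit A) = Ident C (S (on_Obj F A))"
      using C_Comp[OF c u] F_Comp[OF c u] C_Ident[OF SFA] F_Ident[OF SFA] F_S[OF FA] Fu Fc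
        D.Comp_Ident[OF D.Ident_in_hom[OF FA]]
      by (intro F_eqI) auto
    moreover have "Comp C (counit A) u = Ident C A"
      using C_Comp[OF u c] F_Comp[OF u c] C_Ident[OF A] F_Ident[OF A] Fu Fc
        D.Comp_Ident[OF D.Ident_in_hom[OF FA]]
      by (intro F_eqI) auto
    ultimately show ?thesis
      using u in_homD[OF c] by (auto simp: iso_def)
  qed
  show ?thesis
    unfolding nat_iso_def nat_trans_def
    using counit_hom natural[OF in_homI] iso
    by (auto simp: comp_functor_def id_functor_def section_functor_def)
qed

lemma ident_nat_iso: "nat_iso D D (comp_functor F section_functor) id_functor (Ident D)"
proof -
  have iso: "iso D (Ident D B)" if B: "B \<in> Obj D" for B
    using D.Ident_in_hom[OF B] D.Comp_Ident[OF D.Ident_in_hom[OF B]]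
    by (auto simp: iso_def hom_def intro!: bexI[of _ "Ident D B"])
  have "Comp D (Ident D (Cod D f)) (on_Arr F (on_Arr section_functor f)) = Comp D f (Ident D (Dom D f))"
    if f: "f \<in> Arr D" for f
    using F_section[OF in_homI[OF f]] D.Comp_Ident[OF in_homI[OF f]] D.Ident_Comp[OF in_homI[OF f]]
    by simp
  then show ?thesis
    unfolding nat_iso_def nat_trans_def
    using iso D.Ident_in_hom F_S
    by (auto simp: comp_functor_def id_functor_def section_functor_def)
qed

theorem equivalent_C_D: "equivalent C D"
  unfolding equivalent_def
  using functor_F functor_section counit_nat_iso ident_nat_iso by blast

end

locale dagger_fully_faithful_retraction =
  fully_faithful_retraction D C F S + D: dagger_category D
  for D :: "('o2, 'm2, 'z) dagger_category_scheme"
    and C :: "('o1, 'm1, 'y) dagger_category_scheme"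
    and F :: "('o1, 'm1, 'o2, 'm2) functor_data"
    and S :: "'o2 \<Rightarrow> 'o1" +
  assumes C_Dag: "f \<in> hom C A B \<Longrightarrow> Dag C f \<in> hom C B A"
    and F_Dag: "f \<in> hom C A B \<Longrightarrow> on_Arr F (Dag C f) = Dag D (on_Arr F f)"
begin

lemma dagger_category_C: "dagger_category C"
proof
  show "Dag C (Dag C f) = f" if "f \<in> Arr C" for f
    using C_Dag[OF C_Dag[OF in_homI[OF that]]] in_homI[OF that] F_Dag[OF in_homI[OF that]]
      F_Dag[OF C_Dag[OF in_homI[OF that]]] D.Dag_Dag F_hom[OF in_homI[OF that]]
    by (intro F_eqI) (auto dest: in_homD)
  show "Dag C (Ident C A) = Ident C A" if A: "A \<in> Obj C" for A
    using C_Dag[OF C_Ident[OF A]] C_Ident[OF A] F_Dag[OF C_Ident[OF A]]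
      F_Ident[OF A] D.Dag_Ident F_Obj[OF A]
    by (intro F_eqI) auto
  show "Dag C (Comp C g f) = Comp C (Dag C f) (Dag C g)"
    if f: "f \<in> hom C A B" and g: "g \<in> hom C B E" for f g A B E
    using C_Dag[OF C_Comp[OF f g]] C_Comp[OF C_Dag[OF g] C_Dag[OF f]]
      F_Dag[OF C_Comp[OF f g]] F_Comp[OF C_Dag[OF g] C_Dag[OF f]] F_Comp[OF f g]
      F_Dag[OF f] F_Dag[OF g] D.Dag_Comp[OF F_hom[OF f] F_hom[OF g]]
    by (intro F_eqI) auto
qed (rule C_Dag)

lemma dagger_functor_F: "is_dagger_functor C D F"
  unfolding is_dagger_functor_def
  using dagger_category_C D.dagger_category_axioms functor_F F_Dag[OF in_homI] by blast

lemma dagger_functor_section: "is_dagger_functor D C section_functor"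
proof -
  have "on_Arr section_functor (Dag D h) = Dag C (on_Arr section_functor h)" if h: "h \<in> hom D A B" for h A B
    using section_hom[OF D.Dag_in_hom[OF h]] F_section[OF D.Dag_in_hom[OF h]]
      C_Dag[OF section_hom[OF h]] F_Dag[OF section_hom[OF h]] F_section[OF h]
    by (intro F_eqI) auto
  then show ?thesis
    unfolding is_dagger_functor_def
    using dagger_category_C D.dagger_category_axioms functor_section by (auto simp: hom_def)
qed

text \<open>The dagger of the lifted identity again lifts the identity, hence is its inverse.\<close>

lemma unitary_counit:
  assumes A: "A \<in> Obj C"
  shows "unitary C (counit A)"
proof -
  note FA = F_Obj[OF A] and SFA = S_Obj[OF F_Obj[OF A]] and c = counit_hom[OF A]
  note d = C_Dag[OF c]
  have Fd: "on_Arr F (Dag C (counit A)) = Ident D (on_Obj F A)"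
    using F_Dag[OF c] F_counit[OF A] D.Dag_Ident[OF FA] by simp
  have "Comp C (Dag C (counit A)) (counit A) = Ident C (S (on_Obj F A))"
    using C_Comp[OF c d] F_Comp[OF c d] C_Ident[OF SFA] F_Ident[OF SFA] F_S[OF FA] Fd F_counit[OF A]
      D.Comp_Ident[OF D.Ident_in_hom[OF FA]]
    by (intro F_eqI) auto
  moreover have "Comp C (counit A) (Dag C (counit A)) = Ident C A"
    using C_Comp[OF d c] F_Comp[OF d c] C_Ident[OF A] F_Ident[OF A] Fd F_counit[OF A]
      D.Comp_Ident[OF D.Ident_in_hom[OF FA]]
    by (intro F_eqI) auto
  ultimately show ?thesis
    using in_homD[OF c] by (auto simp: unitary_def)
qed

lemma unitary_Ident: "B \<in> Obj D \<Longrightarrow> unitary D (Ident D B)"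
  using D.Ident_in_hom[of B] D.Comp_Ident[OF D.Ident_in_hom[of B]] D.Dag_Ident[of B]
  by (auto simp: unitary_def hom_def)

theorem dagger_equivalent_C_D: "dagger_equivalent C D"
  unfolding dagger_equivalent_def
  using dagger_functor_F dagger_functor_section counit_nat_iso ident_nat_iso
    unitary_counit unitary_Ident by blast

end

section \<open>Total relations and surjections\<close>

lemma total_rel_Id_on: "total_rel R (Id_on R) R"
  by (auto simp: total_rel_def)

lemma total_rel_relcomp: "total_rel R K Q \<Longrightarrow> total_rel Q L V \<Longrightarrow> total_rel R (K O L) V"
  unfolding total_rel_def by blast

lemma total_rel_converse: "total_rel R K Q \<Longrightarrow> total_rel Q (K\<inverse>) R"
  unfolding total_rel_def by blast

lemma TotRel_sel:
  "Obj (TotRel U) = {X \<in> U. X \<noteq> {}}" "Ident (TotRel U) X = (X, Id_on X, X)"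
  "Dom (TotRel U) (X, K, Y) = X" "Cod (TotRel U) (X, K, Y) = Y"
  "Comp (TotRel U) (Y', L, Z) (X, K, Y) = (X, K O L, Z)"
  "Dag (TotRel U) (X, K, Y) = (Y, K\<inverse>, X)"
  by (simp_all add: TotRel_def)

lemma hom_TotRel_iff:
  "a \<in> hom (TotRel U) X Y \<longleftrightarrow> X \<in> Obj (TotRel U) \<and> Y \<in> Obj (TotRel U)
    \<and> (\<exists>K. a = (X, K, Y) \<and> total_rel X K Y)"
  by (auto simp: hom_def TotRel_def)

lemma Arr_TotRelE:
  assumes "a \<in> Arr (TotRel U)"
  obtains X K Y where "a = (X, K, Y)" "total_rel X K Y" "X \<in> Obj (TotRel U)" "Y \<in> Obj (TotRel U)"
  using in_homI[OF assms] unfolding hom_TotRel_iff by blast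

lemma dagger_category_TotRel: "dagger_category (TotRel U)"
proof
  show "Comp (TotRel U) f (Ident (TotRel U) A) = f" "Comp (TotRel U) (Ident (TotRel U) B) f = f"
    if hom: "f \<in> hom (TotRel U) A B" for f A B
  proof -
    obtain K where f: "f = (A, K, B)" and "K \<subseteq> A \<times> B"
      using hom unfolding hom_TotRel_iff total_rel_def by blast
    then have "Id_on A O K = K" "K O Id_on B = K"
      by blast+
    then show "Comp (TotRel U) f (Ident (TotRel U) A) = f"
      "Comp (TotRel U) (Ident (TotRel U) B) f = f"
      by (simp_all add: f TotRel_sel)
  qed
  show "Dag (TotRel U) (Ident (TotRel U) A) = Ident (TotRel U) A" for A
    by (auto simp: TotRel_sel)
qed (auto simp: hom_TotRel_iff TotRel_sel total_rel_Id_on total_rel_relcomp total_rel_converse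
    O_assoc converse_relcomp elim!: Arr_TotRelE intro: total_rel_relcomp)

lemma category_Surj: "category (Surj U)"
proof
  show "Comp (Surj U) g f \<in> hom (Surj U) A E"
    if "f \<in> hom (Surj U) A B" "g \<in> hom (Surj U) B E" for f g A B E
    using that by (auto simp: Surj_def hom_def surj_compose compose_def image_image)
  show "Comp (Surj U) (Comp (Surj U) h g) f = Comp (Surj U) h (Comp (Surj U) g f)"
    if "f \<in> hom (Surj U) A B" "g \<in> hom (Surj U) B B'" "h \<in> hom (Surj U) B' E" for f g h A B B' E
    using that by (auto simp: Surj_def hom_def compose_def fun_eq_iff)
  show "Comp (Surj U) f (Ident (Surj U) A) = f" if "f \<in> hom (Surj U) A B" for f A B
    using that by (auto simp: Surj_def hom_def compose_def fun_eq_iff PiE_def extensional_def)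
  show "Comp (Surj U) (Ident (Surj U) B) f = f" if "f \<in> hom (Surj U) A B" for f A B
    using that by (auto simp: Surj_def hom_def compose_def fun_eq_iff PiE_def extensional_def)
qed (auto simp: Surj_def hom_def)

definition function_of :: "'u set \<Rightarrow> ('u \<times> 'u) set \<Rightarrow> 'u \<Rightarrow> 'u" where
  "function_of X K = (\<lambda>x\<in>X. THE y. (x, y) \<in> K)"

definition graph_on :: "'u set \<Rightarrow> ('u \<Rightarrow> 'u) \<Rightarrow> ('u \<times> 'u) set" where
  "graph_on X f = {(x, f x) | x. x \<in> X}"

lemma function_of_graph_on: "f \<in> X \<rightarrow>\<^sub>E Y \<Longrightarrow> function_of X (graph_on X f) = f"
  by (auto simp: function_of_def graph_on_def fun_eq_iff PiE_def extensional_def)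

lemma total_rel_graph_on: "f ` X = Y \<Longrightarrow> total_rel X (graph_on X f) Y"
  by (auto simp: total_rel_def graph_on_def)

lemma single_valued_graph_on: "single_valued (graph_on X f)"
  by (auto simp: single_valued_def graph_on_def)

lemma function_of_Id_on: "function_of X (Id_on X) = (\<lambda>x\<in>X. x)"
proof -
  have "Id_on X = graph_on X (\<lambda>x\<in>X. x)"
    by (auto simp: graph_on_def)
  then show ?thesis
    using function_of_graph_on[of "\<lambda>x\<in>X. x" X X] by simp
qed

lemma
  assumes "total_rel X K Y" "single_valued K"
  shows graph_on_function_of: "graph_on X (function_of X K) = K"
    and function_of_PiE: "function_of X K \<in> X \<rightarrow>\<^sub>E Y"
    and function_of_image: "function_of X K ` X = Y"
proof -
  have eq: "function_of X K x = y" if "(x, y) \<in> K" for x y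
    using that assms by (auto simp: function_of_def total_rel_def single_valued_def)
  have mem: "(x, function_of X K x) \<in> K" if "x \<in> X" for x
    using that assms(1) eq by (metis total_rel_def)
  have sub: "K \<subseteq> X \<times> Y"
    using assms(1) by (simp add: total_rel_def)
  show "graph_on X (function_of X K) = K"
    unfolding graph_on_def using sub mem eq by blast
  have "function_of X K ` X \<subseteq> Y"
    using sub mem by blast
  moreover have "Y \<subseteq> function_of X K ` X"
  proof
    fix y
    assume "y \<in> Y"
    then obtain x where "x \<in> X" "(x, y) \<in> K"
      using assms(1) by (auto simp: total_rel_def)
    with eq show "y \<in> function_of X K ` X"
      by blast
  qed
  ultimately show 2: "function_of X K ` X = Y"
    by blast
  show "function_of X K \<in> X \<rightarrow>\<^sub>E Y"
    using 2 by (auto simp: function_of_def)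
qed

lemma function_of_relcomp:
  assumes "total_rel X K Y" "single_valued K" "total_rel Y L Z" "single_valued L"
  shows "function_of X (K O L) = compose X (function_of Y L) (function_of X K)"
proof -
  have "K O L = graph_on X (compose X (function_of Y L) (function_of X K))"
    by (subst graph_on_function_of[OF assms(1,2), symmetric],
        subst graph_on_function_of[OF assms(3,4), symmetric])
      (use function_of_PiE[OF assms(1,2)] in \<open>auto simp: graph_on_def compose_def\<close>)
  moreover have "compose X (function_of Y L) (function_of X K) \<in> X \<rightarrow>\<^sub>E Z"
    using function_of_PiE[OF assms(1,2)] function_of_PiE[OF assms(3,4)] by (auto simp: compose_def)
  ultimately show ?thesis
    by (simp add: function_of_graph_on)
qed

section \<open>Almost sure equality and Bayesian inversion of relations\<close>

definition dom_restrict :: "'u set \<Rightarrow> ('u \<times> 'u) set \<Rightarrow> ('u \<times> 'u) set" where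
  "dom_restrict R S = {(x, y) \<in> S. x \<in> R}"

text \<open>The almost sure equality class, for a state supported on \<open>R\<close>, of the relations whose restriction to
  \<open>R\<close> is \<open>K\<close>.\<close>

definition rel_class ::
  "'u set \<Rightarrow> 'u set \<Rightarrow> 'u set \<Rightarrow> ('u \<times> 'u) set \<Rightarrow> 'u rel_arr set" where
  "rel_class X R Y K = {(X, T, Y) | T. left_total_rel X T Y \<and> dom_restrict R T = K}"

lemma total_rel_dom_restrict:
  "left_total_rel X S Y \<Longrightarrow> R \<subseteq> X \<Longrightarrow> total_rel R (dom_restrict R S) (S `` R)"
  by (fastforce simp: left_total_rel_def total_rel_def dom_restrict_def)

text \<open>Fullness comes from this extension of a total relation between supports.\<close>

lemma total_rel_extension:
  assumes "total_rel R K Q" "R \<subseteq> X" "Q \<subseteq> Y" "R \<noteq> {}"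
  obtains S where "left_total_rel X S Y" "dom_restrict R S = K" "S `` R = Q"
proof
  \<comment> \<open>A point outside \<open>R\<close> must be related to something; taking all of \<open>Q\<close> adds no new values.\<close>
  let ?S = "K \<union> (X - R) \<times> Q"
  have K: "K \<subseteq> R \<times> Q" "\<forall>x\<in>R. \<exists>y. (x, y) \<in> K" "\<forall>y\<in>Q. \<exists>x\<in>R. (x, y) \<in> K"
    using assms(1) unfolding total_rel_def by blast+
  then have "Q \<noteq> {}"
    using assms(4) by blast
  then show "left_total_rel X ?S Y"
    using K assms(2,3) unfolding left_total_rel_def by blast
  show "dom_restrict R ?S = K"
    using K(1) by (auto simp: dom_restrict_def)
  show "?S `` R = Q"
    using K by blast
qed

definition support :: "'u rel_arr \<Rightarrow> 'u set" where
  "support p = Range (fst (snd p))"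

lemma support_subset_state [simp]: "support (subset_state pt X R) = R"
  by (auto simp: support_def subset_state_def)

text \<open>All representatives in a class have the same restriction to \<open>R\<close>; the union merely avoids choosing
  one of them.\<close>

definition core :: "'u set \<Rightarrow> 'u rel_arr set \<Rightarrow> ('u \<times> 'u) set" where
  "core R F = dom_restrict R (\<Union>f\<in>F. fst (snd f))"

lemma rel_class_nonempty:
  assumes "total_rel R K Q" "R \<subseteq> X" "Q \<subseteq> Y" "R \<noteq> {}"
  obtains T where "(X, T, Y) \<in> rel_class X R Y K"
  using total_rel_extension[OF assms] by (auto simp: rel_class_def)

lemma core_rel_class:
  assumes "total_rel R K Q" "R \<subseteq> X" "Q \<subseteq> Y" "R \<noteq> {}"
  shows "core R (rel_class X R Y K) = K"
proof -
  obtain T where "(X, T, Y) \<in> rel_class X R Y K"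
    using rel_class_nonempty[OF assms] .
  then show ?thesis
    by (auto simp: core_def rel_class_def dom_restrict_def)
qed

text \<open>Stated for an arbitrary Markov category, so that arrows stay atomic while the definition is
  unfolded.\<close>

lemma hom_Prob_iff:
  "((X, p), F, (Y, q)) \<in> hom (Prob C) A B \<longleftrightarrow> A = (X, p) \<and> B = (Y, q)
    \<and> (X, p) \<in> sample_spaces C \<and> (Y, q) \<in> sample_spaces C
    \<and> (\<exists>f \<in> hom C X Y. F = as_class C p f \<and> Comp C f p = q)"
  unfolding hom_def[of "Prob C"] by (auto simp: Prob_def)

context set_universe
begin

abbreviation SM :: "('u set, 'u rel_arr) markov" where
  "SM \<equiv> SetMulti U pr pt"

abbreviation st :: "'u set \<Rightarrow> 'u set \<Rightarrow> 'u rel_arr" where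
  "st \<equiv> subset_state pt"

lemma SM_sel [simp]:
  "Obj SM = U" "Dom SM (X, S, Y) = X" "Cod SM (X, S, Y) = Y" "Ident SM X = (X, Id_on X, X)"
  "Comp SM (Y', T, Z) (X, S, Y) = (X, S O T, Z)" "UnitObj SM = {pt}"
  by (simp_all add: SetMulti_def)

lemma SM_hom: "f \<in> hom SM X Y \<longleftrightarrow> X \<in> U \<and> Y \<in> U \<and> (\<exists>S. f = (X, S, Y) \<and> left_total_rel X S Y)"
  by (auto simp: hom_def SetMulti_def)

lemma sample_spaces_SM:
  "sample_spaces SM = {(X, st X R) | X R. X \<in> U \<and> R \<noteq> {} \<and> R \<subseteq> X}"
proof -
  have "(X, p) \<in> sample_spaces SM \<longleftrightarrow> (\<exists>R. p = st X R \<and> X \<in> U \<and> R \<noteq> {} \<and> R \<subseteq> X)" for X p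
  proof
    assume "(X, p) \<in> sample_spaces SM"
    then obtain P where P: "X \<in> U" "p = ({pt}, P, X)" "P \<subseteq> {pt} \<times> X" "\<exists>y\<in>X. (pt, y) \<in> P"
      by (auto simp: sample_spaces_def SM_hom left_total_rel_def)
    then have "P = {pt} \<times> Range P" "Range P \<noteq> {}" "Range P \<subseteq> X"
      by auto
    with P show "\<exists>R. p = st X R \<and> X \<in> U \<and> R \<noteq> {} \<and> R \<subseteq> X"
      by (auto simp: subset_state_def)
  qed (auto simp: sample_spaces_def SM_hom left_total_rel_def subset_state_def point_in)
  then show ?thesis
    by (intro set_eqI) (simp add: split_paired_all)
qed

lemma Comp_state: "R \<subseteq> X \<Longrightarrow> Comp SM (X, S, Y) (st X R) = st Y (S `` R)"
  by (auto simp: subset_state_def)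

text \<open>The state on \<open>X \<otimes> Y\<close> that almost sure equality compares: the encoded pairs in the restriction
  of \<open>S\<close> to \<open>R\<close>.\<close>

lemma joint_state:
  assumes "R \<subseteq> X"
  shows "Comp SM (Tensor SM (Ident SM X) (X, S, Y)) (Comp SM (Copy SM X) (st X R))
    = st (times_in pr X Y) {pr x y | x y. x \<in> R \<and> (x, y) \<in> S}"
  using assms by (fastforce simp: SetMulti_def subset_state_def pr_eq_iff)

text \<open>The same state seen from \<open>Y\<close>, as it occurs in the equation for Bayesian inverses.\<close>

lemma joint_state':
  assumes "Q \<subseteq> Y"
  shows "Comp SM (Tensor SM (Y, T, X) (Ident SM Y)) (Comp SM (Copy SM Y) (st Y Q))
    = st (times_in pr X Y) {pr x y | x y. y \<in> Q \<and> (y, x) \<in> T}"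
  using assms by (fastforce simp: SetMulti_def subset_state_def pr_eq_iff)

lemma subset_state_inject: "st X R = st X' R' \<longleftrightarrow> X = X' \<and> R = R'"
  by (auto simp: subset_state_def)

lemma pr_set_eq_iff:
  "{pr x y | x y. P x y} = {pr x y | x y. Q x y} \<longleftrightarrow> (\<forall>x y. P x y \<longleftrightarrow> Q x y)"
proof -
  have "pr x y \<in> {pr x y | x y. P x y} \<longleftrightarrow> P x y" for P x y
    by (auto simp: pr_eq_iff)
  then show ?thesis
    by blast
qed

lemma as_eq_SM:
  assumes "R \<subseteq> X"
  shows "as_eq SM (st X R) (X, S, Y) (X, T, Y) \<longleftrightarrow> dom_restrict R S = dom_restrict R T"
proof -
  have "Cod SM (st X R) = X"
    by (simp add: subset_state_def)
  then show ?thesis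
    unfolding as_eq_def
    by (simp only: joint_state[OF assms] subset_state_inject pr_set_eq_iff)
      (auto simp: dom_restrict_def)
qed

lemma as_class_SM:
  assumes "X \<in> U" "Y \<in> U" "R \<subseteq> X"
  shows "as_class SM (st X R) (X, S, Y) = rel_class X R Y (dom_restrict R S)"
  using assms by (auto simp: as_class_def rel_class_def SM_hom as_eq_SM)

text \<open>Copying the output of \<open>S\<close> yields the pairs \<open>(y, y)\<close>, running \<open>S\<close> twice yields all pairs
  \<open>(y, y')\<close> of values at the same point; these agree on \<open>R\<close> exactly if no point of \<open>R\<close> has two values.\<close>

lemma as_deterministic_SM:
  assumes "left_total_rel X S Y" "R \<subseteq> X"
  shows "as_deterministic SM (st X R) (X, S, Y) \<longleftrightarrow> single_valued (dom_restrict R S)"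
proof -
  have copy_after: "Comp SM (Copy SM Y) (X, S, Y)
      = (X, {(x, pr y y) | x y. (x, y) \<in> S}, times_in pr Y Y)"
    using assms(1) by (auto simp: SetMulti_def left_total_rel_def)
  have copy_before: "Comp SM (Tensor SM (X, S, Y) (X, S, Y)) (Copy SM X)
      = (X, {(x, pr y y') | x y y'. (x, y) \<in> S \<and> (x, y') \<in> S}, times_in pr Y Y)"
    using assms(1) by (fastforce simp: SetMulti_def left_total_rel_def pr_eq_iff)
  let ?d = "dom_restrict R {(x, pr y y) | x y. (x, y) \<in> S}"
  let ?d' = "dom_restrict R {(x, pr y y') | x y y'. (x, y) \<in> S \<and> (x, y') \<in> S}"
  have d: "(x, pr y y') \<in> ?d \<longleftrightarrow> x \<in> R \<and> (x, y) \<in> S \<and> y = y'" for x y y'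
    by (auto simp: dom_restrict_def pr_eq_iff)
  have d': "(x, pr y y') \<in> ?d' \<longleftrightarrow> x \<in> R \<and> (x, y) \<in> S \<and> (x, y') \<in> S" for x y y'
    by (auto simp: dom_restrict_def pr_eq_iff)
  have "?d = ?d' \<longleftrightarrow> (\<forall>x y y'. x \<in> R \<and> (x, y) \<in> S \<and> (x, y') \<in> S \<longrightarrow> y = y')"
  proof
    assume "?d = ?d'"
    with d d' show "\<forall>x y y'. x \<in> R \<and> (x, y) \<in> S \<and> (x, y') \<in> S \<longrightarrow> y = y'"
      by blast
  next
    assume "\<forall>x y y'. x \<in> R \<and> (x, y) \<in> S \<and> (x, y') \<in> S \<longrightarrow> y = y'"
    then show "?d = ?d'"
      by (auto simp: dom_restrict_def)
  qed
  then show ?thesis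
    unfolding as_deterministic_def SM_sel copy_after copy_before as_eq_SM[OF assms(2)]
    by (auto simp: single_valued_def dom_restrict_def)
qed

text \<open>Both joint states list pairs \<open>(x, y)\<close>, on one side with \<open>x \<in> R\<close> and \<open>(x, y) \<in> S\<close>, on the other
  with \<open>y\<close> in the image of \<open>R\<close> and \<open>(y, x)\<close> in the inverse. So the inverses form one almost sure
  equality class, that of the converse.\<close>

lemma bayesian_inverse_SM:
  assumes "X \<in> U" "Y \<in> U" "left_total_rel X S Y" "R \<subseteq> X"
  shows "bayesian_inverse SM (st X R) (X, S, Y) g
    \<longleftrightarrow> g \<in> rel_class Y (S `` R) X ((dom_restrict R S)\<inverse>)"
proof -
  have Q: "S `` R \<subseteq> Y"
    using assms by (auto simp: left_total_rel_def)
  have "bayesian_inverse SM (st X R) (X, S, Y) (Y, T, X)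
    \<longleftrightarrow> left_total_rel Y T X \<and> (\<forall>x y. x \<in> R \<and> (x, y) \<in> S \<longleftrightarrow> y \<in> S `` R \<and> (y, x) \<in> T)" for T
    unfolding bayesian_inverse_def SM_sel(2,3)
    by (simp only: joint_state[OF assms(4)] Comp_state[OF assms(4)] joint_state'[OF Q]
        subset_state_inject pr_set_eq_iff SM_hom) (use assms in simp)
  moreover have "(\<forall>x y. x \<in> R \<and> (x, y) \<in> S \<longleftrightarrow> y \<in> S `` R \<and> (y, x) \<in> T)
    \<longleftrightarrow> dom_restrict (S `` R) T = (dom_restrict R S)\<inverse>" for T
    by (auto simp: dom_restrict_def)
  moreover have "bayesian_inverse SM (st X R) (X, S, Y) g \<Longrightarrow> \<exists>T. g = (Y, T, X)"
    by (auto simp: bayesian_inverse_def SM_hom)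
  ultimately show ?thesis
    by (auto simp: rel_class_def)
qed

text \<open>A point outside \<open>R\<close> is invisible to almost sure equality, but two relations into a two-element set
  can differ there.\<close>

lemma faithful_SM:
  assumes "X \<in> U" "R \<subseteq> X"
  shows "faithful SM (X, st X R) \<longleftrightarrow> R = X"
proof
  assume *: "faithful SM (X, st X R)"
  obtain a b where ab: "a \<noteq> b" "{a, b} \<in> U"
    using two_points_in by blast
  let ?f = "(X, X \<times> {a}, {a, b})" and ?g = "(X, R \<times> {a} \<union> (X - R) \<times> {b}, {a, b})"
  have "as_eq SM (st X R) ?f ?g"
    using assms by (auto simp: as_eq_SM dom_restrict_def)
  moreover have "?f \<in> hom SM X {a, b}" "?g \<in> hom SM X {a, b}"
    using assms ab by (auto simp: SM_hom left_total_rel_def)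
  moreover have "\<forall>Y\<in>U. \<forall>f\<in>hom SM X Y. \<forall>g\<in>hom SM X Y. as_eq SM (st X R) f g \<longrightarrow> f = g"
    using * by (simp add: faithful_def)
  ultimately have "?f = ?g"
    using ab(2) by blast
  then have "X \<times> {a} = R \<times> {a} \<union> (X - R) \<times> {b}"
    by simp
  with ab(1) assms(2) show "R = X"
    by blast
next
  assume "R = X"
  moreover have "dom_restrict X S = S" if "left_total_rel X S Y" for S Y
    using that by (auto simp: dom_restrict_def left_total_rel_def)
  ultimately show "faithful SM (X, st X R)"
    by (auto simp: faithful_def SM_hom as_eq_SM)
qed

section \<open>Probability spaces as total relations between supports\<close>

lemma Obj_Prob: "Obj (Prob SM) = {(X, st X R) | X R. X \<in> U \<and> R \<noteq> {} \<and> R \<subseteq> X}"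
  by (simp add: Prob_def sample_spaces_SM)

text \<open>Preservation of the states makes the restriction of a representative hit all of \<open>Q\<close>; conversely
  the extension of a total relation is a representative.\<close>

lemma hom_Prob:
  assumes "X \<in> U" "R \<noteq> {}" "R \<subseteq> X" "Y \<in> U" "Q \<noteq> {}" "Q \<subseteq> Y"
  shows "hom (Prob SM) (X, st X R) (Y, st Y Q)
    = {((X, st X R), rel_class X R Y K, (Y, st Y Q)) | K. total_rel R K Q}" (is "?L = ?R")
proof (intro equalityI subsetI)
  fix a
  assume a: "a \<in> ?L"
  obtain X' p F Y' q where a': "a = ((X', p), F, (Y', q))"
    by (metis surj_pair)
  have eqs: "X' = X" "p = st X R" "Y' = Y" "q = st Y Q"
    using a unfolding a' hom_Prob_iff by auto
  obtain f where "f \<in> hom SM X Y" "F = as_class SM (st X R) f" "Comp SM f (st X R) = st Y Q"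
    using a unfolding a' hom_Prob_iff eqs by blast
  then obtain S where S: "left_total_rel X S Y" "F = as_class SM (st X R) (X, S, Y)"
    "Comp SM (X, S, Y) (st X R) = st Y Q"
    unfolding SM_hom by blast
  have "S `` R = Q"
    using S(3) unfolding Comp_state[OF assms(3)] subset_state_inject by blast
  with S total_rel_dom_restrict[OF S(1) assms(3)] show "a \<in> ?R"
    unfolding a' eqs using assms by (auto simp: as_class_SM)
next
  fix a
  assume "a \<in> ?R"
  then obtain K where K: "total_rel R K Q" "a = ((X, st X R), rel_class X R Y K, (Y, st Y Q))"
    by auto
  obtain S where S: "left_total_rel X S Y" "dom_restrict R S = K" "S `` R = Q"
    using total_rel_extension[OF K(1)] assms by metis
  have "(X, S, Y) \<in> hom SM X Y"
    using S assms by (auto simp: SM_hom)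
  moreover have "Comp SM (X, S, Y) (st X R) = st Y Q"
    unfolding Comp_state[OF assms(3)] S(3) ..
  moreover have "rel_class X R Y K = as_class SM (st X R) (X, S, Y)"
    unfolding as_class_SM[OF assms(1,4,3)] S(2) ..
  moreover have "(X, st X R) \<in> sample_spaces SM" "(Y, st Y Q) \<in> sample_spaces SM"
    using assms unfolding sample_spaces_SM by blast+
  ultimately show "a \<in> ?L"
    unfolding K(2) hom_Prob_iff by blast
qed

lemma hom_Prob_Obj:
  assumes "a \<in> hom (Prob SM) A B"
  shows "A \<in> Obj (Prob SM)" "B \<in> Obj (Prob SM)"
  using assms by (auto simp: hom_def Prob_def)

lemma hom_ProbE:
  assumes "a \<in> hom (Prob SM) A B"
  obtains X R Y Q K where
    "A = (X, st X R)" "X \<in> U" "R \<noteq> {}" "R \<subseteq> X" "B = (Y, st Y Q)" "Y \<in> U" "Q \<noteq> {}" "Q \<subseteq> Y"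
    "total_rel R K Q" "a = ((X, st X R), rel_class X R Y K, (Y, st Y Q))"
proof -
  obtain X R Y Q where *: "A = (X, st X R)" "X \<in> U" "R \<noteq> {}" "R \<subseteq> X"
    "B = (Y, st Y Q)" "Y \<in> U" "Q \<noteq> {}" "Q \<subseteq> Y"
    using hom_Prob_Obj[OF assms] by (auto simp: Obj_Prob)
  moreover obtain K where "total_rel R K Q" "a = ((X, st X R), rel_class X R Y K, (Y, st Y Q))"
    using assms unfolding *(1,5) hom_Prob[OF *(2-4,6-8)] by blast
  ultimately show ?thesis
    using that by blast
qed

lemma Ident_Prob:
  assumes "X \<in> U" "R \<subseteq> X"
  shows "Ident (Prob SM) (X, st X R) = ((X, st X R), rel_class X R X (Id_on R), (X, st X R))"
proof -
  have "dom_restrict R (Id_on X) = Id_on R"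
    using assms(2) by (auto simp: dom_restrict_def)
  then show ?thesis
    using assms by (simp add: Prob_def as_class_SM)
qed

text \<open>All values of \<open>K\<close> lie in \<open>Q\<close>, so the restriction of a composite depends only on the restrictions
  of its factors. The classes are nonempty, so the union over representatives is this one class.\<close>

lemma Comp_Prob:
  assumes "X \<in> U" "R \<noteq> {}" "R \<subseteq> X" "Y \<in> U" "Q \<noteq> {}" "Q \<subseteq> Y" "Z \<in> U" "V \<subseteq> Z"
    and K: "total_rel R K Q" and L: "total_rel Q L V"
  shows "Comp (Prob SM) (B, rel_class Y Q Z L, E) ((X, st X R), rel_class X R Y K, B')
    = ((X, st X R), rel_class X R Z (K O L), E)"
proof -
  have "as_class SM (st X R) (Comp SM g f) = rel_class X R Z (K O L)"
    if fg: "f \<in> rel_class X R Y K" "g \<in> rel_class Y Q Z L" for f g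
  proof -
    obtain S T where S: "f = (X, S, Y)" "dom_restrict R S = K"
      and T: "g = (Y, T, Z)" "dom_restrict Q T = L"
      using fg by (auto simp: rel_class_def)
    have "K \<subseteq> R \<times> Q"
      using K by (simp add: total_rel_def)
    then have "dom_restrict R (S O T) = K O L"
      unfolding S(2)[symmetric] T(2)[symmetric] by (fastforce simp: dom_restrict_def)
    then show ?thesis
      using S T assms by (simp add: as_class_SM)
  qed
  moreover obtain f where "f \<in> rel_class X R Y K"
    using rel_class_nonempty[OF K] assms by metis
  moreover obtain g where "g \<in> rel_class Y Q Z L"
    using rel_class_nonempty[OF L] assms by metis
  ultimately have "{as_class SM (st X R) (Comp SM g f) | g f.
      g \<in> rel_class Y Q Z L \<and> f \<in> rel_class X R Y K} = {rel_class X R Z (K O L)}"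
    by blast
  then show ?thesis
    by (simp add: Prob_def)
qed

lemma Dag_Prob:
  assumes "X \<in> U" "R \<noteq> {}" "R \<subseteq> X" "Y \<in> U" "Q \<subseteq> Y" and K: "total_rel R K Q"
  shows "Dag (Prob SM) ((X, st X R), rel_class X R Y K, B) = (B, rel_class Y Q X (K\<inverse>), (X, st X R))"
proof -
  have "bayesian_inverse SM (st X R) f g \<longleftrightarrow> g \<in> rel_class Y Q X (K\<inverse>)"
    if f: "f \<in> rel_class X R Y K" for f g
  proof -
    obtain S where S: "f = (X, S, Y)" "left_total_rel X S Y" "dom_restrict R S = K"
      using f by (auto simp: rel_class_def)
    have "S `` R = Range K"
      using S(3) by (auto simp: dom_restrict_def)
    also have "\<dots> = Q"
      using K by (auto simp: total_rel_def)
    finally show ?thesis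
      using S assms by (simp add: bayesian_inverse_SM)
  qed
  moreover obtain f where "f \<in> rel_class X R Y K"
    using rel_class_nonempty[OF K] assms by metis
  ultimately have "{g. \<exists>f\<in>rel_class X R Y K. bayesian_inverse SM (st X R) f g}
      = rel_class Y Q X (K\<inverse>)"
    by blast
  then show ?thesis
    by (simp add: Prob_def)
qed

definition support_functor ::
  "('u set \<times> 'u rel_arr, ('u set, 'u rel_arr) prob_arr, 'u set, 'u rel_arr) functor_data" where
  "support_functor = \<lparr>on_Obj = (\<lambda>(X, p). support p),
     on_Arr = (\<lambda>((X, p), F, (Y, q)). (support p, core (support p) F, support q))\<rparr>"

lemma support_functor_Obj: "on_Obj support_functor (X, st X R) = R"
  by (simp add: support_functor_def)

lemma support_functor_Arr:
  assumes "total_rel R K Q" "R \<subseteq> X" "Q \<subseteq> Y" "R \<noteq> {}"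
  shows "on_Arr support_functor ((X, st X R), rel_class X R Y K, (Y, st Y Q)) = (R, K, Q)"
  using core_rel_class[OF assms] by (simp add: support_functor_def)

lemma Obj_ProbE:
  assumes "A \<in> Obj (Prob SM)"
  obtains X R where "A = (X, st X R)" "X \<in> U" "R \<noteq> {}" "R \<subseteq> X"
  using assms unfolding Obj_Prob by blast

lemma Ident_Prob_hom:
  assumes "A \<in> Obj (Prob SM)"
  shows "Ident (Prob SM) A \<in> hom (Prob SM) A A"
    and "on_Arr support_functor (Ident (Prob SM) A) = Ident (TotRel U) (on_Obj support_functor A)"
proof -
  obtain X R where A: "A = (X, st X R)" and X: "X \<in> U" "R \<noteq> {}" "R \<subseteq> X"
    using assms by (rule Obj_ProbE)
  show "Ident (Prob SM) A \<in> hom (Prob SM) A A"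
    unfolding A Ident_Prob[OF X(1,3)] hom_Prob[OF X X] using total_rel_Id_on by blast
  show "on_Arr support_functor (Ident (Prob SM) A) = Ident (TotRel U) (on_Obj support_functor A)"
    unfolding A Ident_Prob[OF X(1,3)] support_functor_Arr[OF total_rel_Id_on X(3,3,2)]
      support_functor_Obj
    by (simp add: TotRel_def)
qed

lemma Dag_Prob_hom:
  assumes "a \<in> hom (Prob SM) A B"
  shows "Dag (Prob SM) a \<in> hom (Prob SM) B A"
    and "on_Arr support_functor (Dag (Prob SM) a) = Dag (TotRel U) (on_Arr support_functor a)"
proof -
  obtain X R Y Q K where A: "A = (X, st X R)" and X: "X \<in> U" "R \<noteq> {}" "R \<subseteq> X"
    and B: "B = (Y, st Y Q)" and Y: "Y \<in> U" "Q \<noteq> {}" "Q \<subseteq> Y"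
    and K: "total_rel R K Q" and a: "a = ((X, st X R), rel_class X R Y K, (Y, st Y Q))"
    using assms by (rule hom_ProbE)
  note dag = Dag_Prob[OF X Y(1,3) K]
  show "Dag (Prob SM) a \<in> hom (Prob SM) B A"
    unfolding A B a dag hom_Prob[OF Y X] using total_rel_converse[OF K] by blast
  show "on_Arr support_functor (Dag (Prob SM) a) = Dag (TotRel U) (on_Arr support_functor a)"
    unfolding a dag support_functor_Arr[OF K X(3) Y(3) X(2)]
      support_functor_Arr[OF total_rel_converse[OF K] Y(3) X(3) Y(2)]
    by (simp add: TotRel_def)
qed

lemma Comp_Prob_hom:
  assumes "a \<in> hom (Prob SM) A B" "b \<in> hom (Prob SM) B E"
  shows "Comp (Prob SM) b a \<in> hom (Prob SM) A E"
    and "on_Arr support_functor (Comp (Prob SM) b a)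
        = Comp (TotRel U) (on_Arr support_functor b) (on_Arr support_functor a)"
proof -
  obtain X R Y Q K where A: "A = (X, st X R)" and X: "X \<in> U" "R \<noteq> {}" "R \<subseteq> X"
    and B: "B = (Y, st Y Q)" and Y: "Y \<in> U" "Q \<noteq> {}" "Q \<subseteq> Y"
    and K: "total_rel R K Q" and a: "a = ((X, st X R), rel_class X R Y K, (Y, st Y Q))"
    using assms(1) by (rule hom_ProbE)
  obtain Z V where E: "E = (Z, st Z V)" and Z: "Z \<in> U" "V \<noteq> {}" "V \<subseteq> Z"
    using hom_Prob_Obj(2)[OF assms(2)] by (rule Obj_ProbE)
  obtain L where L: "total_rel Q L V" and b: "b = ((Y, st Y Q), rel_class Y Q Z L, (Z, st Z V))"
    using assms(2) unfolding B E hom_Prob[OF Y Z] by blast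
  note comp = Comp_Prob[OF X Y Z(1,3) K L] and KL = total_rel_relcomp[OF K L]
  show "Comp (Prob SM) b a \<in> hom (Prob SM) A E"
    unfolding A E a b comp hom_Prob[OF X Z] using KL by blast
  show "on_Arr support_functor (Comp (Prob SM) b a)
        = Comp (TotRel U) (on_Arr support_functor b) (on_Arr support_functor a)"
    unfolding a b comp support_functor_Arr[OF K X(3) Y(3) X(2)]
      support_functor_Arr[OF L Y(3) Z(3) Y(2)] support_functor_Arr[OF KL X(3) Z(3) X(2)]
    by (simp add: TotRel_def)
qed

lemma support_functor_bij:
  assumes "A \<in> Obj (Prob SM)" "B \<in> Obj (Prob SM)"
  shows "bij_betw (on_Arr support_functor) (hom (Prob SM) A B)
      (hom (TotRel U) (on_Obj support_functor A) (on_Obj support_functor B))"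
proof -
  obtain X R where A: "A = (X, st X R)" and X: "X \<in> U" "R \<noteq> {}" "R \<subseteq> X"
    using assms(1) by (rule Obj_ProbE)
  obtain Y Q where B: "B = (Y, st Y Q)" and Y: "Y \<in> U" "Q \<noteq> {}" "Q \<subseteq> Y"
    using assms(2) by (rule Obj_ProbE)
  note F = support_functor_Arr[OF _ X(3) Y(3) X(2)]
  have hom_TotRel: "hom (TotRel U) R Q = {(R, K, Q) | K. total_rel R K Q}"
    using subset_closed[OF X(1,3)] subset_closed[OF Y(1,3)] X(2) Y(2)
    by (auto simp: hom_TotRel_iff TotRel_sel)
  show ?thesis
    unfolding A B support_functor_Obj hom_Prob[OF X Y] hom_TotRel
    by (rule bij_betwI[where g = "\<lambda>(R', K, Q'). ((X, st X R), rel_class X R Y K, (Y, st Y Q))"])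
      (auto simp: F)
qed

lemma Prob_TotRel:
  "dagger_fully_faithful_retraction (TotRel U) (Prob SM) support_functor (\<lambda>R. (R, st R R))"
proof -
  interpret T: dagger_category "TotRel U"
    by (rule dagger_category_TotRel)
  show ?thesis
  proof
    show "on_Obj support_functor A \<in> Obj (TotRel U)" if "A \<in> Obj (Prob SM)" for A
      using that subset_closed by (auto elim!: Obj_ProbE simp: support_functor_Obj TotRel_def)
    show "(R, st R R) \<in> Obj (Prob SM)" if "R \<in> Obj (TotRel U)" for R
      using that unfolding Obj_Prob TotRel_def by auto
    show "Dom (Prob SM) a \<in> Obj (Prob SM)" "Cod (Prob SM) a \<in> Obj (Prob SM)"
      if "a \<in> Arr (Prob SM)" for a
      using hom_Prob_Obj[OF in_homI[OF that]] by auto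
  next
    fix R
    show "on_Obj support_functor (R, st R R) = R"
      by (rule support_functor_Obj)
  next
    fix A
    assume A: "A \<in> Obj (Prob SM)"
    show "Ident (Prob SM) A \<in> hom (Prob SM) A A"
      "on_Arr support_functor (Ident (Prob SM) A) = Ident (TotRel U) (on_Obj support_functor A)"
      using Ident_Prob_hom[OF A] .
  next
    fix a A B
    assume a: "a \<in> hom (Prob SM) A B"
    show "Dag (Prob SM) a \<in> hom (Prob SM) B A"
      "on_Arr support_functor (Dag (Prob SM) a) = Dag (TotRel U) (on_Arr support_functor a)"
      using Dag_Prob_hom[OF a] .
    fix b E
    assume b: "b \<in> hom (Prob SM) B E"
    show "Comp (Prob SM) b a \<in> hom (Prob SM) A E"
      "on_Arr support_functor (Comp (Prob SM) b a)
        = Comp (TotRel U) (on_Arr support_functor b) (on_Arr support_functor a)"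
      using Comp_Prob_hom[OF a b] .
  next
    fix A B
    assume AB: "A \<in> Obj (Prob SM)" "B \<in> Obj (Prob SM)"
    show "bij_betw (on_Arr support_functor) (hom (Prob SM) A B)
        (hom (TotRel U) (on_Obj support_functor A) (on_Obj support_functor B))"
      using support_functor_bij[OF AB] .
  qed
qed

section \<open>Deterministic morphisms as surjections between supports\<close>

definition function_functor ::
  "('u set \<times> 'u rel_arr, ('u set, 'u rel_arr) prob_arr,
    'u set, 'u set \<times> ('u \<Rightarrow> 'u) \<times> 'u set) functor_data" where
  "function_functor = \<lparr>on_Obj = (\<lambda>(X, p). support p),
     on_Arr = (\<lambda>((X, p), F, (Y, q)).
       (support p, function_of (support p) (core (support p) F), support q))\<rparr>"

lemma function_functor_Obj: "on_Obj function_functor (X, st X R) = R"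
  by (simp add: function_functor_def)

lemma function_functor_Arr:
  assumes "total_rel R K Q" "R \<subseteq> X" "Q \<subseteq> Y" "R \<noteq> {}"
  shows "on_Arr function_functor ((X, st X R), rel_class X R Y K, (Y, st Y Q))
    = (R, function_of R K, Q)"
  using core_rel_class[OF assms] by (simp add: function_functor_def)

lemma hom_Surj:
  assumes "R \<in> U" "R \<noteq> {}" "Q \<in> U" "Q \<noteq> {}"
  shows "hom (Surj U) R Q = {(R, f, Q) | f. f \<in> R \<rightarrow>\<^sub>E Q \<and> f ` R = Q}"
  using assms by (auto simp: hom_def Surj_def)

lemma DetProb_sel:
  "Obj (DetProb SM) = Obj (Prob SM)" "Ident (DetProb SM) = Ident (Prob SM)"
  "Comp (DetProb SM) = Comp (Prob SM)"
  by (simp_all add: DetProb_def)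

lemma hom_DetProb_iff:
  "((X, p), F, B) \<in> hom (DetProb SM) A A' \<longleftrightarrow>
    ((X, p), F, B) \<in> hom (Prob SM) A A' \<and> (\<exists>f\<in>F. as_deterministic SM p f)"
  by (auto simp: hom_def DetProb_def simp del: split_paired_Ex)

lemma rel_class_deterministic_iff:
  assumes "total_rel R K Q" "R \<subseteq> X" "Q \<subseteq> Y" "R \<noteq> {}"
  shows "(\<exists>f\<in>rel_class X R Y K. as_deterministic SM (st X R) f) \<longleftrightarrow> single_valued K"
proof -
  have "as_deterministic SM (st X R) f \<longleftrightarrow> single_valued K" if "f \<in> rel_class X R Y K" for f
    using that assms(2) by (auto simp: rel_class_def as_deterministic_SM)
  moreover obtain T where "(X, T, Y) \<in> rel_class X R Y K"
    using rel_class_nonempty[OF assms] .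
  ultimately show ?thesis
    by blast
qed

text \<open>Determinism depends on \<open>K\<close> alone, so it does not matter which representative is deterministic.\<close>

lemma hom_DetProb:
  assumes X: "X \<in> U" "R \<noteq> {}" "R \<subseteq> X" and Y: "Y \<in> U" "Q \<noteq> {}" "Q \<subseteq> Y"
  shows "hom (DetProb SM) (X, st X R) (Y, st Y Q) = {((X, st X R), rel_class X R Y K, (Y, st Y Q))
      | K. total_rel R K Q \<and> single_valued K}" (is "?L = ?R")
proof -
  have *: "((X, st X R), rel_class X R Y K, (Y, st Y Q)) \<in> ?L \<longleftrightarrow> single_valued K"
    if K: "total_rel R K Q" for K
  proof -
    have "((X, st X R), rel_class X R Y K, (Y, st Y Q)) \<in> hom (Prob SM) (X, st X R) (Y, st Y Q)"
      unfolding hom_Prob[OF X Y] using K by blast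
    then show ?thesis
      by (simp only: hom_DetProb_iff rel_class_deterministic_iff[OF K X(3) Y(3) X(2)] simp_thms)
  qed
  show ?thesis
  proof (intro equalityI subsetI)
    fix a
    assume a: "a \<in> ?L"
    obtain X' p F B where a': "a = ((X', p), F, B)"
      by (metis surj_pair)
    have "a \<in> hom (Prob SM) (X, st X R) (Y, st Y Q)"
      using a unfolding a' hom_DetProb_iff by (rule conjunct1)
    then obtain K where "total_rel R K Q" "a = ((X, st X R), rel_class X R Y K, (Y, st Y Q))"
      unfolding hom_Prob[OF X Y] by blast
    with a * show "a \<in> ?R"
      by blast
  next
    fix a
    assume "a \<in> ?R"
    then obtain K where "total_rel R K Q" "single_valued K"
      "a = ((X, st X R), rel_class X R Y K, (Y, st Y Q))"
      by blast
    with * show "a \<in> ?L"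
      by simp
  qed
qed

lemma hom_DetProb_Obj:
  assumes "a \<in> hom (DetProb SM) A B"
  shows "A \<in> Obj (Prob SM)" "B \<in> Obj (Prob SM)"
proof -
  obtain X p F C where a: "a = ((X, p), F, C)"
    by (metis surj_pair)
  show "A \<in> Obj (Prob SM)" "B \<in> Obj (Prob SM)"
    using assms hom_Prob_Obj unfolding a hom_DetProb_iff by blast+
qed

lemma Ident_DetProb_hom:
  assumes "A \<in> Obj (Prob SM)"
  shows "Ident (DetProb SM) A \<in> hom (DetProb SM) A A"
    and "on_Arr function_functor (Ident (DetProb SM) A) = Ident (Surj U) (on_Obj function_functor A)"
proof -
  obtain X R where A: "A = (X, st X R)" and X: "X \<in> U" "R \<noteq> {}" "R \<subseteq> X"
    using assms by (rule Obj_ProbE)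
  have "single_valued (Id_on R)"
    by (auto simp: single_valued_def)
  then show "Ident (DetProb SM) A \<in> hom (DetProb SM) A A"
    unfolding A DetProb_sel Ident_Prob[OF X(1,3)] hom_DetProb[OF X X]
    using total_rel_Id_on by blast
  show "on_Arr function_functor (Ident (DetProb SM) A) = Ident (Surj U) (on_Obj function_functor A)"
    unfolding A DetProb_sel Ident_Prob[OF X(1,3)] function_functor_Obj
      function_functor_Arr[OF total_rel_Id_on X(3,3,2)]
    by (simp add: Surj_def function_of_Id_on)
qed

lemma Comp_DetProb_hom:
  assumes "a \<in> hom (DetProb SM) A B" "b \<in> hom (DetProb SM) B E"
  shows "Comp (DetProb SM) b a \<in> hom (DetProb SM) A E"
    and "on_Arr function_functor (Comp (DetProb SM) b a)
        = Comp (Surj U) (on_Arr function_functor b) (on_Arr function_functor a)"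
proof -
  obtain X R where A: "A = (X, st X R)" and X: "X \<in> U" "R \<noteq> {}" "R \<subseteq> X"
    using hom_DetProb_Obj(1)[OF assms(1)] by (rule Obj_ProbE)
  obtain Y Q where B: "B = (Y, st Y Q)" and Y: "Y \<in> U" "Q \<noteq> {}" "Q \<subseteq> Y"
    using hom_DetProb_Obj(2)[OF assms(1)] by (rule Obj_ProbE)
  obtain Z V where E: "E = (Z, st Z V)" and Z: "Z \<in> U" "V \<noteq> {}" "V \<subseteq> Z"
    using hom_DetProb_Obj(2)[OF assms(2)] by (rule Obj_ProbE)
  obtain K where K: "total_rel R K Q" "single_valued K"
    and a: "a = ((X, st X R), rel_class X R Y K, (Y, st Y Q))"
    using assms(1) unfolding A B hom_DetProb[OF X Y] by blast
  obtain L where L: "total_rel Q L V" "single_valued L"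
    and b: "b = ((Y, st Y Q), rel_class Y Q Z L, (Z, st Z V))"
    using assms(2) unfolding B E hom_DetProb[OF Y Z] by blast
  note comp = Comp_Prob[OF X Y Z(1,3) K(1) L(1)] and KL = total_rel_relcomp[OF K(1) L(1)]
  show "Comp (DetProb SM) b a \<in> hom (DetProb SM) A E"
    unfolding A E a b DetProb_sel comp hom_DetProb[OF X Z]
    using KL single_valued_relcomp[OF K(2) L(2)] by blast
  show "on_Arr function_functor (Comp (DetProb SM) b a)
        = Comp (Surj U) (on_Arr function_functor b) (on_Arr function_functor a)"
    unfolding a b DetProb_sel comp function_functor_Arr[OF K(1) X(3) Y(3) X(2)]
      function_functor_Arr[OF L(1) Y(3) Z(3) Y(2)] function_functor_Arr[OF KL X(3) Z(3) X(2)]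
    by (simp add: Surj_def function_of_relcomp[OF K L])
qed

lemma function_functor_bij:
  assumes "A \<in> Obj (Prob SM)" "B \<in> Obj (Prob SM)"
  shows "bij_betw (on_Arr function_functor) (hom (DetProb SM) A B)
      (hom (Surj U) (on_Obj function_functor A) (on_Obj function_functor B))"
proof -
  obtain X R where A: "A = (X, st X R)" and X: "X \<in> U" "R \<noteq> {}" "R \<subseteq> X"
    using assms(1) by (rule Obj_ProbE)
  obtain Y Q where B: "B = (Y, st Y Q)" and Y: "Y \<in> U" "Q \<noteq> {}" "Q \<subseteq> Y"
    using assms(2) by (rule Obj_ProbE)
  note F = function_functor_Arr[OF _ X(3) Y(3) X(2)]
  show ?thesis
    unfolding A B function_functor_Obj hom_DetProb[OF X Y]
      hom_Surj[OF subset_closed[OF X(1,3)] X(2) subset_closed[OF Y(1,3)] Y(2)]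
  proof (rule bij_betwI[where
        g = "\<lambda>(R', f, Q'). ((X, st X R), rel_class X R Y (graph_on R f), (Y, st Y Q))"],
      goal_cases)
    case 1
    show ?case
      using function_of_PiE function_of_image by (fastforce simp: F)
  next
    case 2
    show ?case
      using total_rel_graph_on single_valued_graph_on by fastforce
  next
    case 3
    then show ?case
      by (auto simp: F graph_on_function_of)
  next
    case (4 h)
    then obtain f where h: "h = (R, f, Q)" and f: "f \<in> R \<rightarrow>\<^sub>E Q" "f ` R = Q"
      by blast
    show ?case
      unfolding h prod.case F[OF total_rel_graph_on[OF f(2)]] function_of_graph_on[OF f(1)] ..
  qed
qed

lemma DetProb_Surj:
  "fully_faithful_retraction (Surj U) (DetProb SM) function_functor (\<lambda>R. (R, st R R))"
proof -
  interpret category "Surj U"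
    by (rule category_Surj)
  show ?thesis
  proof (unfold_locales, unfold DetProb_sel(1))
    show "on_Obj function_functor A \<in> Obj (Surj U)" if "A \<in> Obj (Prob SM)" for A
      using that subset_closed by (auto elim!: Obj_ProbE simp: function_functor_Obj Surj_def)
    show "(R, st R R) \<in> Obj (Prob SM)" if "R \<in> Obj (Surj U)" for R
      using that unfolding Obj_Prob Surj_def by auto
    show "Dom (DetProb SM) a \<in> Obj (Prob SM)" "Cod (DetProb SM) a \<in> Obj (Prob SM)"
      if "a \<in> Arr (DetProb SM)" for a
      using hom_DetProb_Obj[OF in_homI[OF that]] by auto
  next
    fix R
    show "on_Obj function_functor (R, st R R) = R"
      by (rule function_functor_Obj)
  next
    fix A
    assume A: "A \<in> Obj (Prob SM)"
    show "Ident (DetProb SM) A \<in> hom (DetProb SM) A A"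
      "on_Arr function_functor (Ident (DetProb SM) A) = Ident (Surj U) (on_Obj function_functor A)"
      using Ident_DetProb_hom[OF A] .
  next
    fix a b A B E
    assume ab: "a \<in> hom (DetProb SM) A B" "b \<in> hom (DetProb SM) B E"
    show "Comp (DetProb SM) b a \<in> hom (DetProb SM) A E"
      "on_Arr function_functor (Comp (DetProb SM) b a)
        = Comp (Surj U) (on_Arr function_functor b) (on_Arr function_functor a)"
      using Comp_DetProb_hom[OF ab] .
  next
    fix A B
    assume AB: "A \<in> Obj (Prob SM)" "B \<in> Obj (Prob SM)"
    show "bij_betw (on_Arr function_functor) (hom (DetProb SM) A B)
        (hom (Surj U) (on_Obj function_functor A) (on_Obj function_functor B))"
      using function_functor_bij[OF AB] .
  qed
qed

end

theorem proposition6: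
  fixes U :: "'u set set" and pr :: "'u \<Rightarrow> 'u \<Rightarrow> 'u" and pt :: 'u
  assumes "set_universe U pr pt"
  shows "(\<forall>X R. X \<in> U \<and> R \<noteq> {} \<and> R \<subseteq> X \<longrightarrow>
            (faithful (SetMulti U pr pt) (X, subset_state pt X R) \<longleftrightarrow> R = X))
         \<and> dagger_equivalent (Prob (SetMulti U pr pt)) (TotRel U)
         \<and> equivalent (DetProb (SetMulti U pr pt)) (Surj U)"
proof -
  interpret set_universe U pr pt
    by (rule assms)
  interpret P: dagger_fully_faithful_retraction
    "TotRel U" "Prob SM" support_functor "\<lambda>R. (R, st R R)"
    by (rule Prob_TotRel)
  interpret S: fully_faithful_retraction
    "Surj U" "DetProb SM" function_functor "\<lambda>R. (R, st R R)"
    by (rule DetProb_Surj)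
  show ?thesis
    using faithful_SM P.dagger_equivalent_C_D S.equivalent_C_D by blast
qed

end
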